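(* Let $d$ be prime, $n\ge1$, $G$ invertible over $\mathbb Z_d$, and $\rho,\sigma$ $n$-qudit states, with $\vec\lambda_\tau$ the eigenvalue vector of $\tau$. (1) If $G$ is odd-parity positive, then $\vec\lambda_{\rho\boxtimes\sigma}\prec\vec\lambda_\sigma$, hence $f(\rho\boxtimes\sigma)\ge f(\sigma)$ for every Schur-concave $f$. (2) If $G$ is even-parity positive, then $\vec\lambda_{\rho\boxtimes\sigma}\prec\vec\lambda_\rho$, hence $f(\rho\boxtimes\sigma)\ge f(\rho)$ for every Schur-concave $f$. (3) If $G$ is positive, both hold, hence $f(\rho\boxtimes\sigma)\ge\max\{f(\rho),f(\sigma)\}$ for every Schur-concave $f$.
   Context: Fix a prime $d$. Let $G=\begin{pmatrix}g_{00}&g_{01}\\ g_{10}&g_{11}\end{pmatrix}$ over $\mathbb Z_d$ with $\det G\not\equiv0$, $N=(\det G)^{-1}$. $G$ is nontrivial if at most one entry is $0$ mod $d$; odd-parity positive if nontrivial and $g_{01},g_{10}\not\equiv0$; even-parity positive if nontrivial and $g_{00},g_{11}\not\equiv0$; positive if both. Key unitary on $(\mathbb C^d)^{\otimes n}\otimes(\mathbb C^d)^{\otimes n}$: $U|\vec i\rangle|\vec j\rangle=|Ng_{11}\vec i-Ng_{10}\vec j\rangle|-Ng_{01}\vec i+Ng_{00}\vec j\rangle$; convolution $\rho\boxtimes\sigma=\mathrm{Tr}_B[U(\rho\otimes\sigma)U^\dagger]$. Majorization $\vec p\prec\vec q$ of probability vectors: $\sum_{i\le k}p^\downarrow_i\le\sum_{i\le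 k}q^\downarrow_i$ for all $k$ (decreasing rearrangements). $f$ is Schur concave if $\vec p\prec\vec q\Rightarrow f(\vec p)\ge f(\vec q)$; $f(\rho):=f(\vec\lambda_\rho)$. *)

theory Defs
  imports "Jordan_Normal_Form.Matrix" "Jordan_Normal_Form.Char_Poly" "HOL-Number_Theory.Cong"
begin

definition adj :: "complex mat \<Rightarrow> complex mat" where
  "adj A = mat (dim_col A) (dim_row A) (\<lambda>(i,j). cnj (A $$ (j,i)))"

definition density_op :: "nat \<Rightarrow> complex mat \<Rightarrow> bool" where
  "density_op D \<rho> \<longleftrightarrow> \<rho> \<in> carrier_mat D D \<and> adj \<rho> = \<rho> \<and>
     (\<forall>v. (\<Sum>i<D. \<Sum>j<D. cnj (v i) * \<rho> $$ (i,j) * v j) \<in> \<real> \<and>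
          0 \<le> Re (\<Sum>i<D. \<Sum>j<D. cnj (v i) * \<rho> $$ (i,j) * v j)) \<and>
     (\<Sum>i<D. \<rho> $$ (i,i)) = 1"

text \<open>Kronecker (tensor) product; basis |i>|j> is index i * dim B + j.\<close>
definition kron :: "complex mat \<Rightarrow> complex mat \<Rightarrow> complex mat" where
  "kron A B = mat (dim_row A * dim_row B) (dim_col A * dim_col B)
     (\<lambda>(r,c). A $$ (r div dim_row B, c div dim_col B) * B $$ (r mod dim_row B, c mod dim_col B))"

definition ptrace_B :: "nat \<Rightarrow> complex mat \<Rightarrow> complex mat" where
  "ptrace_B D A = mat D D (\<lambda>(i,j). \<Sum>k<D. A $$ (i * D + k, j * D + k))"

section \<open>Qudits: basis of (C^d)^n indexed by 0..<d^n, digits = vectors in Z_d^n\<close>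

definition digit :: "nat \<Rightarrow> nat \<Rightarrow> nat \<Rightarrow> nat" where
  "digit d i k = (i div d ^ k) mod d"

text \<open>Index of the basis vector |alpha * vec(i) + beta * vec(j)> (componentwise mod d).\<close>
definition lin_idx :: "nat \<Rightarrow> nat \<Rightarrow> int \<Rightarrow> int \<Rightarrow> nat \<Rightarrow> nat \<Rightarrow> nat" where
  "lin_idx d n \<alpha> \<beta> i j =
     (\<Sum>k<n. nat ((\<alpha> * int (digit d i k) + \<beta> * int (digit d j k)) mod int d) * d ^ k)"

definition inv_det :: "nat \<Rightarrow> int \<Rightarrow> int \<Rightarrow> int \<Rightarrow> int \<Rightarrow> int" where
  "inv_det d g00 g01 g10 g11 = (SOME N. [N * (g00 * g11 - g01 * g10) = 1] (mod int d))"

text \<open>Key unitary U |i>|j> = |N g11 i - N g10 j>|-N g01 i + N g00 j>, as a permutation matrix.\<close>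
definition key_U :: "nat \<Rightarrow> nat \<Rightarrow> int \<Rightarrow> int \<Rightarrow> int \<Rightarrow> int \<Rightarrow> complex mat" where
  "key_U d n g00 g01 g10 g11 =
    (let D = d ^ n; N = inv_det d g00 g01 g10 g11;
         Umap = (\<lambda>c. lin_idx d n (N * g11) (- N * g10) (c div D) (c mod D) * D
                     + lin_idx d n (- N * g01) (N * g00) (c div D) (c mod D))
     in mat (D * D) (D * D) (\<lambda>(r,c). if r = Umap c then 1 else 0))"

definition conv :: "nat \<Rightarrow> nat \<Rightarrow> int \<Rightarrow> int \<Rightarrow> int \<Rightarrow> int \<Rightarrow> complex mat \<Rightarrow> complex mat \<Rightarrow> complex mat" where
  "conv d n g00 g01 g10 g11 \<rho> \<sigma> =
    (let U = key_U d n g00 g01 g10 g11 in ptrace_B (d ^ n) (U * kron \<rho> \<sigma> * adj U))"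

definition nontrivial_G :: "nat \<Rightarrow> int \<Rightarrow> int \<Rightarrow> int \<Rightarrow> int \<Rightarrow> bool" where
  "nontrivial_G d g00 g01 g10 g11 \<longleftrightarrow>
     card {k \<in> {0,1,2,3::nat}. [[g00,g01,g10,g11] ! k = 0] (mod int d)} \<le> 1"

definition odd_parity_positive :: "nat \<Rightarrow> int \<Rightarrow> int \<Rightarrow> int \<Rightarrow> int \<Rightarrow> bool" where
  "odd_parity_positive d g00 g01 g10 g11 \<longleftrightarrow> nontrivial_G d g00 g01 g10 g11 \<and>
     \<not> [g01 = 0] (mod int d) \<and> \<not> [g10 = 0] (mod int d)"

definition even_parity_positive :: "nat \<Rightarrow> int \<Rightarrow> int \<Rightarrow> int \<Rightarrow> int \<Rightarrow> bool" where
  "even_parity_positive d g00 g01 g10 g11 \<longleftrightarrow> nontrivial_G d g00 g01 g10 g11 \<and>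
     \<not> [g00 = 0] (mod int d) \<and> \<not> [g11 = 0] (mod int d)"

definition positive_G :: "nat \<Rightarrow> int \<Rightarrow> int \<Rightarrow> int \<Rightarrow> int \<Rightarrow> bool" where
  "positive_G d g00 g01 g10 g11 \<longleftrightarrow>
     odd_parity_positive d g00 g01 g10 g11 \<and> even_parity_positive d g00 g01 g10 g11"

text \<open>Eigenvalue vector (with multiplicity, in some order) of a square matrix:
  the roots of the characteristic polynomial; real parts (the matrices considered are Hermitian).\<close>
definition eigvals :: "complex mat \<Rightarrow> real list" where
  "eigvals A = map Re (SOME ev. length ev = dim_row A \<and>
                        char_poly A = (\<Prod>a\<leftarrow>ev. [:- a, 1:]))"

definition prob_vec :: "real list \<Rightarrow> bool" where
  "prob_vec p \<longleftrightarrow> (\<forall>x\<in>set p. 0 \<le> x) \<and> sum_list p = 1"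

definition majorized :: "real list \<Rightarrow> real list \<Rightarrow> bool" (infix "\<prec>\<^sub>m" 50) where
  "p \<prec>\<^sub>m q \<longleftrightarrow> length p = length q \<and>
     (\<forall>k \<le> length p. sum_list (take k (rev (sort p))) \<le> sum_list (take k (rev (sort q))))"

definition schur_concave :: "(real list \<Rightarrow> real) \<Rightarrow> bool" where
  "schur_concave f \<longleftrightarrow>
     (\<forall>p q. prob_vec p \<longrightarrow> prob_vec q \<longrightarrow> p \<prec>\<^sub>m q \<longrightarrow> f p \<ge> f q)"

end

theory Submission
  imports Defs "Jordan_Normal_Form.Schur_Decomposition" "HOL-Combinatorics.Permutations"
begin

text \<open>
  In the computational basis the convolution has the entries
  \<open>\<Sum>\<^sub>k \<rho>(\<phi>(x,k), \<phi>(y,k)) \<sigma>(\<psi>(x,k), \<psi>(y,k))\<close> with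
  \<open>\<phi>(x,k) = g00 x + g10 k\<close> and \<open>\<psi>(x,k) = g01 x + g11 k\<close>.
  If \<open>g01\<close> and \<open>g10\<close> are invertible, then \<open>\<sigma> \<mapsto> \<rho> \<boxtimes> \<sigma>\<close> is positive, trace preserving and
  unital. For eigenbases \<open>v\<close> of \<open>\<rho> \<boxtimes> \<sigma>\<close> and \<open>w\<close> of \<open>\<sigma>\<close>, the numbers
  \<open>S\<^sub>i\<^sub>j = \<langle>v\<^sub>i, (\<rho> \<boxtimes> w\<^sub>j w\<^sub>j\<^sup>*) v\<^sub>i\<rangle>\<close> therefore form a doubly stochastic matrix that maps the
  eigenvalues of \<open>\<sigma>\<close> to those of \<open>\<rho> \<boxtimes> \<sigma>\<close>, which is majorization. The even case is the same
  with the two states exchanged.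
\<close>

section \<open>Spectral theorem for Hermitian matrices\<close>

lemma adj_carrier [simp]: "A \<in> carrier_mat n m \<Longrightarrow> adj A \<in> carrier_mat m n"
  by (auto simp: adj_def)

lemma dim_adj [simp]: "dim_row (adj A) = dim_col A" "dim_col (adj A) = dim_row A"
  by (simp_all add: adj_def)

lemma adj_index: "i < dim_col A \<Longrightarrow> j < dim_row A \<Longrightarrow> adj A $$ (i,j) = cnj (A $$ (j,i))"
  by (simp add: adj_def)

lemma adj_adj [simp]: "adj (adj A) = A"
  by (rule eq_matI) (auto simp: adj_def)

lemma adj_mult:
  assumes "A \<in> carrier_mat n m" "B \<in> carrier_mat m l"
  shows "adj (A * B) = adj B * adj A"
  using assms by (intro eq_matI) (auto simp: adj_def scalar_prod_def mult.commute)

text \<open>Completing \<open>v\<close> to a basis and applying Gram-Schmidt keeps \<open>v\<close>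
  in first place. The result is only orthogonal, so every column is divided by its norm, and
  \<open>c\<close> is the reciprocal norm of \<open>v\<close>.\<close>

lemma unitary_with_first_col:
  fixes v :: "complex vec"
  assumes v: "v \<in> carrier_vec n" and v0: "v \<noteq> 0\<^sub>v n"
  obtains W c where "W \<in> carrier_mat n n" "adj W * W = 1\<^sub>m n" "W * adj W = 1\<^sub>m n"
    "col W 0 = c \<cdot>\<^sub>v v"
proof -
  interpret cof_vec_space n "TYPE(complex)" .
  have n: "n \<noteq> 0"
  proof
    assume "n = 0"
    with v v0 show False by (auto intro: eq_vecI)
  qed
  define b where "b = basis_completion v"
  from basis_completion[OF v v0, folded b_def]
  have dist_b: "distinct b" and indep: "\<not> lin_dep (set b)" and b: "set b \<subseteq> carrier_vec n"
    and hdb: "hd b = v" and len_b: "length b = n" by auto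
  from hdb len_b n obtain vs where bv: "b = v # vs" by (cases b) auto
  define ws where "ws = gram_schmidt n b"
  from gram_schmidt_result[OF b dist_b indep refl, folded ws_def]
  have ws: "set ws \<subseteq> carrier_vec n" "corthogonal ws" "length ws = n"
    by (auto simp: len_b)
  from gram_schmidt_hd[OF v, of vs, folded bv] have hdws: "hd ws = v" unfolding ws_def .
  have ws_nth: "ws ! i \<in> carrier_vec n" if "i < n" for i
    using ws that by auto
  define s where "s i = (\<Sum>x<n. (cmod (ws ! i $ x))\<^sup>2)" for i
  have sprod: "ws ! j \<bullet>c ws ! i = (\<Sum>x<n. ws ! j $ x * cnj (ws ! i $ x))" if "i < n" "j < n" for i j
    using ws_nth[OF that(1)] ws_nth[OF that(2)] by (simp add: scalar_prod_def lessThan_atLeast0)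
  have sc: "ws ! i \<bullet>c ws ! i = of_real (s i)" if "i < n" for i
    unfolding sprod[OF that that] s_def of_real_sum
    by (rule sum.cong) (simp_all only: complex_norm_square)
  have s_pos: "s i > 0" if "i < n" for i
  proof -
    have "s i \<noteq> 0" using corthogonalD[OF ws(2), of i i] sc[OF that] that ws(3) by auto
    moreover have "s i \<ge> 0" unfolding s_def by (intro sum_nonneg) auto
    ultimately show ?thesis by simp
  qed
  define W where "W = mat n n (\<lambda>(x,i). ws ! i $ x / complex_of_real (sqrt (s i)))"
  have W: "W \<in> carrier_mat n n" unfolding W_def by simp
  have WW: "adj W * W = 1\<^sub>m n"
  proof (rule eq_matI)
    fix i j assume "i < dim_row (1\<^sub>m n :: complex mat)" "j < dim_col (1\<^sub>m n :: complex mat)"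
    hence i: "i < n" and j: "j < n" by auto
    have "(adj W * W) $$ (i,j) = (\<Sum>x<n. cnj (W $$ (x,i)) * W $$ (x,j))"
      using W i j by (simp add: scalar_prod_def adj_index lessThan_atLeast0)
    also have "\<dots> = (\<Sum>x<n. ws ! j $ x * cnj (ws ! i $ x)) / (of_real (sqrt (s i)) * of_real (sqrt (s j)))"
      using i j by (simp add: W_def sum_divide_distrib mult.commute)
    also have "\<dots> = (ws ! j \<bullet>c ws ! i) / (of_real (sqrt (s i)) * of_real (sqrt (s j)))"
      using sprod[OF i j] by simp
    also have "\<dots> = 1\<^sub>m n $$ (i,j)"
    proof (cases "i = j")
      case True
      have "complex_of_real (sqrt (s j)) * complex_of_real (sqrt (s j)) = of_real (s j)"
        using s_pos[OF j] by (metis less_imp_le of_real_mult real_sqrt_mult_self abs_of_nonneg)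
      thus ?thesis using True j sc[OF j] s_pos[OF j] by simp
    next
      case False
      thus ?thesis using corthogonalD[OF ws(2), of j i] ws(3) i j by simp
    qed
    finally show "(adj W * W) $$ (i,j) = 1\<^sub>m n $$ (i,j)" .
  qed (use W in auto)
  have "W * adj W = 1\<^sub>m n"
    using mat_mult_left_right_inverse[OF _ W WW] W by simp
  moreover have "col W 0 = (1 / complex_of_real (sqrt (s 0))) \<cdot>\<^sub>v v"
  proof -
    have "ws ! 0 = v" using hdws ws(3) n by (simp add: hd_conv_nth[symmetric] flip: length_0_conv)
    thus ?thesis using n v by (intro eq_vecI) (auto simp: W_def)
  qed
  ultimately show thesis using that W WW by blast
qed

text \<open>Deflation: rotating an eigenvector for the first root into the first unit vector splits
  off a 1 by 1 block, and the induction continues on the rest. The list \<open>es\<close> is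
  arbitrary and its order survives on the diagonal, so the result fits whichever list of roots
  \<open>eigvals\<close> selects.\<close>

theorem hermitian_unitary_diagonalization:
  fixes A :: "complex mat"
  assumes "A \<in> carrier_mat n n" "adj A = A" "char_poly A = (\<Prod>e\<leftarrow>es. [:- e, 1:])"
  shows "\<exists>P. similar_mat_wit A (mat n n (\<lambda>(i,j). if i = j then es ! i else 0)) P (adj P)"
  using assms
proof (induction es arbitrary: n A)
  case Nil
  with degree_monic_char_poly[of A n] have "n = 0" by simp
  with Nil(1) have "similar_mat_wit A (mat n n (\<lambda>(i,j). if i = j then [] ! i else 0)) (1\<^sub>m 0) (adj (1\<^sub>m 0))"
    by (intro similar_mat_witI[of _ _ n]) (auto intro!: eq_matI simp: adj_def)
  thus ?case by blast
next
  case (Cons e es n A)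
  note A = Cons.prems(1)
  have cp: "char_poly A = [: -e, 1 :] * (\<Prod>e \<leftarrow> es. [:- e, 1:])" using Cons.prems by simp
  hence e: "eigenvalue A e" unfolding eigenvalue_root_char_poly[OF A] by simp
  define v where "v = find_eigenvector A e"
  from find_eigenvector[OF A e] A
  have v: "v \<in> carrier_vec n" and v0: "v \<noteq> 0\<^sub>v n" and Av: "A *\<^sub>v v = e \<cdot>\<^sub>v v"
    unfolding v_def eigenvector_def by auto
  have n: "n \<noteq> 0"
  proof
    assume "n = 0"
    with v v0 show False by (auto intro: eq_vecI)
  qed
  define m where "m = n - 1"
  have nm: "n = 1 + m" using n unfolding m_def by simp
  obtain W c where W: "W \<in> carrier_mat n n" and WW: "adj W * W = 1\<^sub>m n" and WW': "W * adj W = 1\<^sub>m n"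
    and colW: "col W 0 = c \<cdot>\<^sub>v v" using unitary_with_first_col[OF v v0] by blast
  have W': "adj W \<in> carrier_mat n n" using W by simp
  define A' where "A' = adj W * A * W"
  have A': "A' \<in> carrier_mat n n" using A W W' unfolding A'_def by auto
  have simA: "similar_mat_wit A A' W (adj W)"
  proof (rule similar_mat_witI[OF WW' WW _ A A' W W'])
    have "W * A' * adj W = (W * adj W) * A * (W * adj W)"
      unfolding A'_def using W W' A
      by (smt (verit) assoc_mult_mat mult_carrier_mat)
    thus "A = W * A' * adj W" using WW' A by simp
  qed
  have hA': "adj A' = A'"
    unfolding A'_def using A W W' Cons.prems(2)
    by (simp add: adj_mult[of _ n n _ n] assoc_mult_mat[of _ n n _ n _ n])
  \<comment> \<open>Column 0 of \<open>W\<close> is a multiple of \<open>v\<close>, hence satisfies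
    the eigenvalue equation for \<open>e\<close>, and \<open>adj W\<close> sends it to the first
    unit vector.\<close>
  have col0: "col A' 0 = e \<cdot>\<^sub>v unit_vec n 0"
  proof -
    have "col A' 0 = (adj W * A) *\<^sub>v col W 0"
      unfolding A'_def using W W' A n by (intro col_mult2) auto
    also have "\<dots> = adj W *\<^sub>v (A *\<^sub>v col W 0)"
      using W W' A n by (intro assoc_mult_mat_vec) auto
    also have "A *\<^sub>v col W 0 = e \<cdot>\<^sub>v col W 0"
      using A v Av by (simp add: colW mult_mat_vec smult_smult_assoc mult.commute)
    also have "adj W *\<^sub>v (e \<cdot>\<^sub>v col W 0) = e \<cdot>\<^sub>v (adj W *\<^sub>v col W 0)"
      using W W' n by (intro mult_mat_vec) auto
    also have "adj W *\<^sub>v col W 0 = col (adj W * W) 0"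
      using W W' n by (intro col_mult2[symmetric]) auto
    finally show ?thesis unfolding WW using n by simp
  qed
  have A'_col: "A' $$ (i,0) = (if i = 0 then e else 0)" if "i < n" for i
  proof -
    have "A' $$ (i,0) = col A' 0 $ i" using A' n that by simp
    thus ?thesis unfolding col0 using that n by simp
  qed
  \<comment> \<open>Hermiticity carries the zeros of the first column over to the first row, which
    makes \<open>A'\<close> block diagonal rather than just block triangular.\<close>
  have A'_row: "A' $$ (0,i) = (if i = 0 then e else 0)" if "i < n" for i
  proof (cases "i = 0")
    case True thus ?thesis using A'_col that by simp
  next
    case False
    have "A' $$ (0,i) = adj A' $$ (0,i)" unfolding hA' ..
    also have "\<dots> = cnj (A' $$ (i,0))" using A' n that by (simp add: adj_index)
    finally show ?thesis using A'_col[OF that] False by simp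
  qed
  define A3 where "A3 = mat m m (\<lambda>(i,j). A' $$ (Suc i, Suc j))"
  have A3: "A3 \<in> carrier_mat m m" unfolding A3_def by simp
  have block: "A' = four_block_mat (mat 1 1 (\<lambda>_. e)) (0\<^sub>m 1 m) (0\<^sub>m m 1) A3"
    using A' nm A'_row A'_col by (intro eq_matI) (auto simp: A3_def four_block_mat_def Let_def)
  have hA3: "adj A3 = A3"
  proof (rule eq_matI)
    fix i j assume "i < dim_row A3" "j < dim_col A3"
    hence ij: "i < m" "j < m" using A3 by auto
    have "cnj (A' $$ (Suc j, Suc i)) = adj A' $$ (Suc i, Suc j)"
      using ij nm A' by (simp add: adj_index)
    hence "cnj (A' $$ (Suc j, Suc i)) = A' $$ (Suc i, Suc j)" unfolding hA' .
    thus "adj A3 $$ (i,j) = A3 $$ (i,j)" using ij by (simp add: adj_def A3_def)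
  qed (use A3 in auto)
  have "char_poly A = char_poly A'"
    using simA char_poly_similar unfolding similar_mat_def by blast
  also have "\<dots> = char_poly (mat 1 1 (\<lambda>_. e)) * char_poly A3"
    unfolding block by (rule char_poly_four_block_zeros_col[OF _ _ A3]) auto
  also have "char_poly (mat 1 1 (\<lambda>_. e)) = [:-e, 1:]"
    by (subst char_poly_upper_triangular[of _ 1]) (auto simp: diag_mat_def)
  \<comment> \<open>Cancelling the common factor \<open>[:- e, 1:]\<close> leaves exactly the
    remaining roots, in their given order.\<close>
  finally have "char_poly A3 = (\<Prod>e \<leftarrow> es. [:- e, 1:])"
    unfolding cp by (simp del: mult_pCons_left mult_pCons_right)
  from Cons.IH[OF A3 hA3 this] obtain P where
    P: "similar_mat_wit A3 (mat m m (\<lambda>(i,j). if i = j then es ! i else 0)) P (adj P)" by blast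
  have Pc: "P \<in> carrier_mat m m" using similar_mat_witD2[OF A3 P] by blast
  let ?P = "four_block_mat (1\<^sub>m 1) (0\<^sub>m 1 m) (0\<^sub>m m 1) P"
  have aP: "adj ?P = four_block_mat (1\<^sub>m 1) (0\<^sub>m 1 m) (0\<^sub>m m 1) (adj P)"
    using Pc by (intro eq_matI) (auto simp: adj_def four_block_mat_def Let_def)
  have D: "four_block_mat (mat 1 1 (\<lambda>_. e)) (0\<^sub>m 1 m) (0\<^sub>m m 1) (mat m m (\<lambda>(i,j). if i = j then es ! i else 0))
      = mat n n (\<lambda>(i,j). if i = j then (e # es) ! i else 0)"
    unfolding nm by (intro eq_matI) (auto simp: four_block_mat_def Let_def nth_Cons')
  have "similar_mat_wit (four_block_mat (mat 1 1 (\<lambda>_. e)) (0\<^sub>m 1 m) (0\<^sub>m m 1) A3)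
      (four_block_mat (mat 1 1 (\<lambda>_. e)) (0\<^sub>m 1 m) (0\<^sub>m m 1) (mat m m (\<lambda>(i,j). if i = j then es ! i else 0)))
      ?P (four_block_mat (1\<^sub>m 1) (0\<^sub>m 1 m) (0\<^sub>m m 1) (adj P))"
    by (rule similar_mat_wit_four_block[OF similar_mat_wit_refl P _ _ _ A3]) (use Pc in auto)
  hence "similar_mat_wit A' (mat n n (\<lambda>(i,j). if i = j then (e # es) ! i else 0)) ?P (adj ?P)"
    unfolding block[symmetric] D aP .
  from similar_mat_wit_trans[OF simA this]
  have "similar_mat_wit A (mat n n (\<lambda>(i,j). if i = j then (e # es) ! i else 0)) (W * ?P) (adj (W * ?P))"
    using W Pc nm by (subst adj_mult[of _ n n _ n]) auto
  thus ?case by blast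
qed

text \<open>The diagonalization in entries, so that later arguments are manipulations of finite
  sums. Unitarity is recorded twice, as orthonormality and as completeness of the eigenvectors: the
  first normalises single eigenvectors, the second evaluates sums over a whole eigenbasis.\<close>

lemma hermitian_eigvals_decomposition:
  fixes A :: "complex mat"
  assumes A: "A \<in> carrier_mat D D" and h: "adj A = A"
  obtains v :: "nat \<Rightarrow> nat \<Rightarrow> complex" where
    "length (eigvals A) = D"
    "\<And>i j. i < D \<Longrightarrow> j < D \<Longrightarrow> (\<Sum>x<D. cnj (v i x) * v j x) = (if i = j then 1 else 0)"
    "\<And>x y. x < D \<Longrightarrow> y < D \<Longrightarrow> (\<Sum>i<D. v i x * cnj (v i y)) = (if x = y then 1 else 0)"
    "\<And>x y. x < D \<Longrightarrow> y < D \<Longrightarrow>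
       A $$ (x,y) = (\<Sum>i<D. of_real (eigvals A ! i) * v i x * cnj (v i y))"
proof -
  \<comment> \<open>This is the same choice term as in \<open>eigvals\<close>; a suitable list
    exists because complex polynomials split.\<close>
  define es where "es = (SOME ev. length ev = dim_row A \<and> char_poly A = (\<Prod>a\<leftarrow>ev. [:- a, 1:]))"
  have "length es = dim_row A \<and> char_poly A = (\<Prod>a\<leftarrow>es. [:- a, 1:])"
    unfolding es_def by (rule someI_ex) (use char_poly_factorized[OF A] A in auto)
  hence len: "length es = D" and cp: "char_poly A = (\<Prod>a\<leftarrow>es. [:- a, 1:])" using A by auto
  have ev: "eigvals A = map Re es" unfolding eigvals_def es_def ..
  let ?E = "mat D D (\<lambda>(i,j). if i = j then es ! i else 0)"
  obtain P where sim: "similar_mat_wit A ?E P (adj P)"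
    using hermitian_unitary_diagonalization[OF A h cp] by blast
  note simD = similar_mat_witD2[OF A sim]
  have P: "P \<in> carrier_mat D D"
    and PP': "P * adj P = 1\<^sub>m D" and P'P: "adj P * P = 1\<^sub>m D" and dec: "A = P * ?E * adj P"
    by (fact simD)+
  define v where "v i x = P $$ (x,i)" for i x
  have o1: "(\<Sum>x<D. cnj (v i x) * v j x) = (if i = j then 1 else 0)" if "i < D" "j < D" for i j
  proof -
    have "(\<Sum>x<D. cnj (v i x) * v j x) = (adj P * P) $$ (i,j)"
      using P that by (simp add: scalar_prod_def adj_index lessThan_atLeast0 v_def)
    thus ?thesis using that by (simp add: P'P)
  qed
  have o2: "(\<Sum>i<D. v i x * cnj (v i y)) = (if x = y then 1 else 0)" if "x < D" "y < D" for x y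
  proof -
    have "(\<Sum>i<D. v i x * cnj (v i y)) = (P * adj P) $$ (x,y)"
      using P that by (simp add: scalar_prod_def adj_index lessThan_atLeast0 v_def)
    thus ?thesis using that by (simp add: PP')
  qed
  have PE: "(P * ?E) $$ (x,i) = es ! i * v i x" if "x < D" "i < D" for x i
  proof -
    have "(P * ?E) $$ (x,i) = (\<Sum>j<D. v j x * (if j = i then es ! j else 0))"
      using P that by (simp add: scalar_prod_def lessThan_atLeast0 v_def)
    also have "\<dots> = (\<Sum>j<D. if j = i then v j x * es ! j else 0)" by (rule sum.cong) auto
    also have "\<dots> = es ! i * v i x" using that by (simp add: mult.commute)
    finally show ?thesis .
  qed
  have dec': "A $$ (x,y) = (\<Sum>i<D. es ! i * v i x * cnj (v i y))" if "x < D" "y < D" for x y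
  proof -
    have "A $$ (x,y) = ((P * ?E) * adj P) $$ (x,y)" using dec by simp
    also have "\<dots> = (\<Sum>i<D. (P * ?E) $$ (x,i) * adj P $$ (i,y))"
      using P that by (simp add: scalar_prod_def lessThan_atLeast0 del: index_mult_mat(1) add: index_mult_mat(1)[of x "P * ?E"])
    also have "\<dots> = (\<Sum>i<D. es ! i * v i x * cnj (v i y))"
      using P that by (intro sum.cong) (auto simp del: index_mult_mat(1) simp: PE adj_index v_def)
    finally show ?thesis .
  qed
  \<comment> \<open>The diagonal form equals \<open>adj P * A * P\<close> and is therefore
    Hermitian. Its diagonal is real, so taking \<open>Re\<close> in \<open>eigvals\<close> loses
    nothing.\<close>
  have "adj ?E = ?E"
  proof -
    have c: "?E \<in> carrier_mat D D" "adj P \<in> carrier_mat D D" using P by auto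
    have E: "?E = adj P * A * P"
      using similar_mat_witD2(3)[OF c(1) similar_mat_wit_sym[OF sim]] .
    show ?thesis unfolding E using A P c h
      by (simp add: adj_mult[of _ D D _ D] assoc_mult_mat[of _ D D _ D _ D])
  qed
  hence E_diag: "adj ?E $$ (i,i) = ?E $$ (i,i)" for i by simp
  have "cnj (es ! i) = es ! i" if "i < D" for i using E_diag[of i] that by (simp add: adj_index)
  hence real: "of_real (Re (es ! i)) = es ! i" if "i < D" for i
    using that by (simp add: complex_eq_iff)
  show thesis
  proof (rule that[of v])
    show "A $$ (x,y) = (\<Sum>i<D. of_real (eigvals A ! i) * v i x * cnj (v i y))" if "x < D" "y < D" for x y
      unfolding dec'[OF that] by (rule sum.cong) (auto simp: ev len real)
  qed (use o1 o2 in \<open>auto simp: ev len\<close>)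
qed

section \<open>Doubly stochastic matrices and majorization\<close>

text \<open>Weights capped at 1 with total \<open>k\<close> do best when they sit fully on the
  \<open>k\<close> largest values. This is the partial sum inequality of majorization.\<close>

lemma sum_weighted_le_sum_prefix:
  fixes m t :: "nat \<Rightarrow> real"
  assumes anti: "\<And>i j. i \<le> j \<Longrightarrow> j < D \<Longrightarrow> m j \<le> m i"
    and t0: "\<And>j. j < D \<Longrightarrow> 0 \<le> t j" and t1: "\<And>j. j < D \<Longrightarrow> t j \<le> 1"
    and st: "(\<Sum>j<D. t j) = real k" and k: "k \<le> D"
  shows "(\<Sum>j<D. t j * m j) \<le> (\<Sum>j<k. m j)"
proof (cases "k = 0")
  case True
  with st have "\<forall>j<D. t j = 0"
    using sum_nonneg_eq_0_iff[of "{..<D}" t] t0 by auto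
  thus ?thesis using True by simp
next
  case False
  \<comment> \<open>Subtracting the threshold value \<open>c\<close> from \<open>m\<close> shifts both sides by \<open>k * c\<close> and makes the
    comparison hold term by term.\<close>
  define c where "c = m (k - 1)"
  have "(\<Sum>j<D. t j * (m j - c)) \<le> (\<Sum>j<D. if j < k then m j - c else 0)"
  proof (rule sum_mono)
    fix j assume "j \<in> {..<D}"
    hence j: "j < D" by simp
    show "t j * (m j - c) \<le> (if j < k then m j - c else 0)"
    proof (cases "j < k")
      case True
      hence "m j - c \<ge> 0" using anti[of j "k - 1"] k unfolding c_def by simp
      thus ?thesis using True t1[OF j] mult_right_mono[of "t j" 1 "m j - c"] by simp
    next
      case False
      hence "m j - c \<le> 0" using anti[of "k - 1" j] j unfolding c_def by simp
      thus ?thesis using False t0[OF j] by (simp add: mult_nonneg_nonpos)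
    qed
  qed
  also have "\<dots> = (\<Sum>j\<in>{..<D} \<inter> {j. j < k}. m j - c)"
    by (simp add: sum.inter_restrict)
  also have "{..<D} \<inter> {j. j < k} = {..<k}" using k by auto
  finally have "(\<Sum>j<D. t j * m j) - (\<Sum>j<D. t j) * c \<le> (\<Sum>j<k. m j) - real k * c"
    by (simp add: right_diff_distrib sum_subtractf sum_distrib_right)
  thus ?thesis using st by simp
qed

lemma rev_sort_permutation:
  fixes xs :: "real list"
  obtains p where "bij_betw p {..<length xs} {..<length xs}"
    "\<And>i. i < length xs \<Longrightarrow> rev (sort xs) ! i = xs ! p i"
proof -
  have "mset (rev (sort xs)) = mset xs" by simp
  from mset_eq_permutation[OF this] obtain p where
    p: "p permutes {..<length xs}" "permute_list p xs = rev (sort xs)" .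
  show thesis
    using that[of p] p permutes_imp_bij[OF p(1)] permute_list_nth[OF p(1)] by simp
qed

lemma rev_sort_antimono:
  fixes xs :: "real list"
  assumes "i \<le> j" "j < length xs"
  shows "rev (sort xs) ! j \<le> rev (sort xs) ! i"
  using assms by (auto simp: rev_nth intro!: sorted_nth_mono)

lemma sum_list_take_eq_sum:
  "k \<le> length xs \<Longrightarrow> sum_list (take k xs) = (\<Sum>i<k. xs ! i)"
  by (simp add: sum_list_sum_nth min_def lessThan_atLeast0)

text \<open>The elementary direction of the Hardy-Littlewood-Polya theorem. The sum of the
  \<open>k\<close> largest entries of \<open>p\<close> is a weighted sum of the entries of
  \<open>q\<close>; column sums bound each weight by 1, and row sums make the total weight
  \<open>k\<close>.\<close>

theorem majorized_if_doubly_stochastic: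
  fixes S :: "nat \<Rightarrow> nat \<Rightarrow> real"
  assumes len: "length p = D" "length q = D"
    and S0: "\<And>i j. i < D \<Longrightarrow> j < D \<Longrightarrow> 0 \<le> S i j"
    and row: "\<And>i. i < D \<Longrightarrow> (\<Sum>j<D. S i j) = 1"
    and col: "\<And>j. j < D \<Longrightarrow> (\<Sum>i<D. S i j) = 1"
    and pq: "\<And>i. i < D \<Longrightarrow> p ! i = (\<Sum>j<D. S i j * q ! j)"
  shows "p \<prec>\<^sub>m q"
  unfolding majorized_def
proof (intro conjI allI impI)
  show "length p = length q" using len by simp
  fix k assume "k \<le> length p"
  hence k: "k \<le> D" using len by simp
  obtain a where a: "bij_betw a {..<D} {..<D}" "\<And>i. i < D \<Longrightarrow> rev (sort p) ! i = p ! a i"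
    using rev_sort_permutation[of p] len by metis
  obtain b where b: "bij_betw b {..<D} {..<D}" "\<And>i. i < D \<Longrightarrow> rev (sort q) ! i = q ! b i"
    using rev_sort_permutation[of q] len by metis
  have aD: "a i < D" if "i < D" for i using a(1) that by (auto dest: bij_betwE)
  have bD: "b i < D" if "i < D" for i using b(1) that by (auto dest: bij_betwE)
  \<comment> \<open>\<open>t j\<close> is the total weight that entry \<open>j\<close> of the
    decreasing rearrangement of \<open>q\<close> receives in the sum of the \<open>k\<close> largest
    entries of \<open>p\<close>.\<close>
  define t where "t j = (\<Sum>i<k. S (a i) (b j))" for j
  have "sum_list (take k (rev (sort p))) = (\<Sum>i<k. p ! a i)"
    using k len a(2) by (simp add: sum_list_take_eq_sum)
  also have "\<dots> = (\<Sum>i<k. \<Sum>j<D. S (a i) (b j) * q ! b j)"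
  proof (rule sum.cong)
    fix i assume "i \<in> {..<k}"
    hence "a i < D" using k aD by simp
    thus "p ! a i = (\<Sum>j<D. S (a i) (b j) * q ! b j)"
      using pq sum.reindex_bij_betw[OF b(1), of "\<lambda>j. S (a i) j * q ! j"] by simp
  qed simp
  also have "\<dots> = (\<Sum>j<D. t j * rev (sort q) ! j)"
    unfolding t_def by (subst sum.swap) (simp add: sum_distrib_right b(2))
  also have "\<dots> \<le> (\<Sum>j<k. rev (sort q) ! j)"
  proof (rule sum_weighted_le_sum_prefix[OF _ _ _ _ k])
    show "rev (sort q) ! j \<le> rev (sort q) ! i" if "i \<le> j" "j < D" for i j
      using rev_sort_antimono that len by simp
    show "0 \<le> t j" if "j < D" for j
      unfolding t_def using that k by (intro sum_nonneg S0 aD bD) auto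
    show "t j \<le> 1" if "j < D" for j
    proof -
      have "t j \<le> (\<Sum>i<D. S (a i) (b j))"
        unfolding t_def using that k by (intro sum_mono2 S0 aD bD) auto
      also have "\<dots> = (\<Sum>i<D. S i (b j))"
        by (rule sum.reindex_bij_betw[OF a(1)])
      finally show ?thesis using col bD[OF that] by simp
    qed
    have "(\<Sum>j<D. t j) = (\<Sum>i<k. \<Sum>j<D. S (a i) (b j))"
      unfolding t_def by (rule sum.swap)
    also have "\<dots> = (\<Sum>i<k. 1)"
    proof (rule sum.cong)
      fix i assume "i \<in> {..<k}"
      hence "a i < D" using k aD by simp
      thus "(\<Sum>j<D. S (a i) (b j)) = 1"
        using row sum.reindex_bij_betw[OF b(1), of "\<lambda>j. S (a i) j"] by simp
    qed simp
    finally show "(\<Sum>j<D. t j) = real k" by simp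
  qed
  also have "\<dots> = sum_list (take k (rev (sort q)))"
    using k len by (simp add: sum_list_take_eq_sum)
  finally show "sum_list (take k (rev (sort p))) \<le> sum_list (take k (rev (sort q)))" .
qed

section \<open>Spectra of convolution-type matrices\<close>

lemma density_opD:
  assumes "density_op D A"
  shows "A \<in> carrier_mat D D" "adj A = A" "(\<Sum>i<D. A $$ (i,i)) = 1"
    "(\<Sum>i<D. \<Sum>j<D. cnj (v i) * A $$ (i,j) * v j) \<in> \<real>"
    "0 \<le> Re (\<Sum>i<D. \<Sum>j<D. cnj (v i) * A $$ (i,j) * v j)"
  using assms unfolding density_op_def by blast+

lemma hermitian_cnj_index:
  assumes "A \<in> carrier_mat D D" "adj A = A" "i < D" "j < D"
  shows "cnj (A $$ (i,j)) = A $$ (j,i)"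
  using adj_index[of j A i] assms by simp

lemma eigenvalue_quadratic_form:
  fixes v :: "nat \<Rightarrow> nat \<Rightarrow> complex" and l :: "nat \<Rightarrow> complex"
  assumes orth: "\<And>i j. i < D \<Longrightarrow> j < D \<Longrightarrow> (\<Sum>x<D. cnj (v i x) * v j x) = (if i = j then 1 else 0)"
    and dec: "\<And>x y. x < D \<Longrightarrow> y < D \<Longrightarrow> A $$ (x,y) = (\<Sum>i<D. l i * v i x * cnj (v i y))"
    and i: "i < D"
  shows "(\<Sum>x<D. \<Sum>y<D. cnj (v i x) * A $$ (x,y) * v i y) = l i"
proof -
  have "(\<Sum>x<D. \<Sum>y<D. cnj (v i x) * A $$ (x,y) * v i y)
      = (\<Sum>x<D. \<Sum>y<D. \<Sum>j<D. l j * (cnj (v i x) * v j x) * (cnj (v j y) * v i y))"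
    by (intro sum.cong refl) (simp add: dec sum_distrib_left sum_distrib_right mult_ac)
  also have "\<dots> = (\<Sum>x<D. \<Sum>j<D. \<Sum>y<D. l j * (cnj (v i x) * v j x) * (cnj (v j y) * v i y))"
    by (rule sum.cong[OF refl], rule sum.swap)
  also have "\<dots> = (\<Sum>j<D. \<Sum>x<D. \<Sum>y<D. l j * (cnj (v i x) * v j x) * (cnj (v j y) * v i y))"
    by (rule sum.swap)
  also have "\<dots> = (\<Sum>j<D. l j * (\<Sum>x<D. cnj (v i x) * v j x) * (\<Sum>y<D. cnj (v j y) * v i y))"
    by (simp add: sum_distrib_left sum_distrib_right mult_ac)
  also have "\<dots> = (\<Sum>j<D. if j = i then l j else 0)"
    by (intro sum.cong refl) (use i in \<open>auto simp: orth\<close>)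
  also have "\<dots> = l i" using i by simp
  finally show ?thesis .
qed

text \<open>Evaluating the quadratic form at an eigenvector gives nonnegativity, and the trace gives
  the sum. \<open>schur_concave\<close> compares probability vectors only, so this fact is required
  before it can be applied.\<close>

lemma prob_vec_eigvals:
  assumes "density_op D A"
  shows "prob_vec (eigvals A)"
proof -
  note A = density_opD[OF assms]
  obtain v where len: "length (eigvals A) = D"
    and o1: "\<And>i j. i < D \<Longrightarrow> j < D \<Longrightarrow> (\<Sum>x<D. cnj (v i x) * v j x) = (if i = j then 1 else 0)"
    and o2: "\<And>x y. x < D \<Longrightarrow> y < D \<Longrightarrow> (\<Sum>i<D. v i x * cnj (v i y)) = (if x = y then 1 else 0)"
    and dec: "\<And>x y. x < D \<Longrightarrow> y < D \<Longrightarrow>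
       A $$ (x,y) = (\<Sum>i<D. of_real (eigvals A ! i) * v i x * cnj (v i y))"
    by (rule hermitian_eigvals_decomposition[OF A(1,2)], rule that; simp)
  have "0 \<le> eigvals A ! i" if "i < D" for i
    using A(5)[of "v i"] eigenvalue_quadratic_form[OF o1 dec that] by simp
  moreover have "complex_of_real (sum_list (eigvals A)) = of_real 1"
  proof -
    have "complex_of_real (sum_list (eigvals A)) = (\<Sum>i<D. of_real (eigvals A ! i) * (\<Sum>x<D. cnj (v i x) * v i x))"
      by (simp add: o1 sum_list_sum_nth len atLeast0LessThan)
    also have "\<dots> = (\<Sum>i<D. \<Sum>x<D. of_real (eigvals A ! i) * v i x * cnj (v i x))"
      by (simp add: sum_distrib_left mult_ac)
    also have "\<dots> = (\<Sum>x<D. \<Sum>i<D. of_real (eigvals A ! i) * v i x * cnj (v i x))"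
      by (rule sum.swap)
    also have "\<dots> = 1" using A(3) by (simp flip: dec)
    finally show ?thesis by simp
  qed
  ultimately show ?thesis
    unfolding prob_vec_def of_real_eq_iff by (auto simp: in_set_conv_nth len)
qed

text \<open>Each \<open>x\<close> contributes at the single point \<open>f x\<close>, and
  coefficients over a common fibre add up, so \<open>f\<close> may fail to be injective. This
  matters for x -> g00 x + g10 k with \<open>k\<close> fixed, which is constant when g00 vanishes
  mod d.\<close>

lemma sum_pushforward:
  fixes a F :: "nat \<Rightarrow> complex"
  assumes "\<And>x. x < D \<Longrightarrow> f x < D"
  shows "(\<Sum>p<D. (\<Sum>x<D. if f x = p then a x else 0) * F p) = (\<Sum>x<D. a x * F (f x))"
proof -
  have "(\<Sum>p<D. (\<Sum>x<D. if f x = p then a x else 0) * F p)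
      = (\<Sum>p<D. \<Sum>x<D. if p = f x then a x * F p else 0)"
    unfolding sum_distrib_right by (intro sum.cong refl) auto
  also have "\<dots> = (\<Sum>x<D. \<Sum>p<D. if p = f x then a x * F p else 0)"
    by (rule sum.swap)
  also have "\<dots> = (\<Sum>x<D. a x * F (f x))"
    using assms by (intro sum.cong refl) simp
  finally show ?thesis .
qed

text \<open>The form at \<open>a\<close> is the form of \<open>A\<close> at the push-forward of \<open>a\<close> along \<open>f\<close>.\<close>
lemma density_op_pullback_nonneg:
  fixes a :: "nat \<Rightarrow> complex"
  assumes A: "density_op D A" and f: "\<And>x. x < D \<Longrightarrow> f x < D"
  defines "Q \<equiv> (\<Sum>x<D. \<Sum>y<D. cnj (a x) * A $$ (f x, f y) * a y)"
  shows "Q \<in> \<real>" "0 \<le> Re Q"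
proof -
  define b where "b p = (\<Sum>x<D. if f x = p then a x else 0)" for p
  have b: "(\<Sum>p<D. b p * F p) = (\<Sum>x<D. a x * F (f x))" for F
    unfolding b_def by (rule sum_pushforward[OF f])
  have cb: "(\<Sum>p<D. cnj (b p) * F p) = (\<Sum>x<D. cnj (a x) * F (f x))" for F
  proof -
    have "cnj (b p) = (\<Sum>x<D. if f x = p then cnj (a x) else 0)" for p
      unfolding b_def by (simp add: if_distrib cong: if_cong)
    thus ?thesis by (simp add: sum_pushforward[OF f])
  qed
  have "(\<Sum>p<D. \<Sum>q<D. cnj (b p) * A $$ (p,q) * b q) = (\<Sum>p<D. cnj (b p) * (\<Sum>q<D. b q * A $$ (p,q)))"
    by (simp add: sum_distrib_left mult_ac)
  also have "\<dots> = (\<Sum>x<D. cnj (a x) * (\<Sum>y<D. a y * A $$ (f x, f y)))"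
    unfolding cb b ..
  also have "\<dots> = Q" unfolding Q_def by (simp add: sum_distrib_left mult_ac)
  finally have "(\<Sum>p<D. \<Sum>q<D. cnj (b p) * A $$ (p,q) * b q) = Q" .
  thus "Q \<in> \<real>" "0 \<le> Re Q" using density_opD(4,5)[OF A, of b] by auto
qed

lemma sum_rotate3:
  "(\<Sum>x\<in>X. \<Sum>y\<in>Y. \<Sum>k\<in>K. f x y k) = (\<Sum>k\<in>K. \<Sum>x\<in>X. \<Sum>y\<in>Y. f x y k)"
proof -
  have "(\<Sum>x\<in>X. \<Sum>y\<in>Y. \<Sum>k\<in>K. f x y k) = (\<Sum>x\<in>X. \<Sum>k\<in>K. \<Sum>y\<in>Y. f x y k)"
    by (rule sum.cong[OF refl], rule sum.swap)
  also have "\<dots> = (\<Sum>k\<in>K. \<Sum>x\<in>X. \<Sum>y\<in>Y. f x y k)" by (rule sum.swap)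
  finally show ?thesis .
qed

lemma sum_diagonal:
  fixes f :: "nat \<Rightarrow> nat \<Rightarrow> complex"
  assumes "\<And>x y. x < D \<Longrightarrow> y < D \<Longrightarrow> g x y = (if x = y then 1 else 0)"
  shows "(\<Sum>x<D. \<Sum>y<D. f x y * g x y) = (\<Sum>x<D. f x x)"
proof -
  have "(\<Sum>x<D. \<Sum>y<D. f x y * g x y) = (\<Sum>x<D. \<Sum>y<D. if x = y then f x y else 0)"
    by (intro sum.cong refl) (auto simp: assms)
  thus ?thesis by simp
qed

text \<open>Each bijection serves one purpose: \<open>\<psi>\<close> in its first argument and
  \<open>\<phi>\<close> in its second give the row sums of \<open>S\<close>, the joint map gives the
  column sums. Keeping \<open>\<phi>\<close> and \<open>\<psi>\<close> abstract allows both parities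
  to be treated by exchanging the two states.\<close>

theorem eigvals_convolution_majorized:
  fixes \<phi> \<psi> :: "nat \<Rightarrow> nat \<Rightarrow> nat"
  assumes A: "density_op D A" and B: "density_op D B" and C: "C \<in> carrier_mat D D"
    and C_index: "\<And>x y. x < D \<Longrightarrow> y < D \<Longrightarrow>
      C $$ (x,y) = (\<Sum>k<D. A $$ (\<phi> x k, \<phi> y k) * B $$ (\<psi> x k, \<psi> y k))"
    and \<phi>: "\<And>x. x < D \<Longrightarrow> bij_betw (\<phi> x) {..<D} {..<D}"
    and \<psi>: "\<And>k. k < D \<Longrightarrow> bij_betw (\<lambda>x. \<psi> x k) {..<D} {..<D}"
    and \<phi>\<psi>: "bij_betw (\<lambda>(x,k). (\<phi> x k, \<psi> x k)) ({..<D} \<times> {..<D}) ({..<D} \<times> {..<D})"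
  shows "eigvals C \<prec>\<^sub>m eigvals B" "prob_vec (eigvals C)"
proof -
  note A' = density_opD[OF A] and B' = density_opD[OF B]
  have \<phi>D: "\<phi> x k < D" if "x < D" "k < D" for x k using bij_betwE[OF \<phi>[OF that(1)]] that by simp
  have \<psi>D: "\<psi> x k < D" if "x < D" "k < D" for x k using bij_betwE[OF \<psi>[OF that(2)]] that by simp
  have \<psi>_inj: "\<psi> x k = \<psi> y k \<longleftrightarrow> x = y" if "x < D" "y < D" "k < D" for x y k
    using bij_betw_imp_inj_on[OF \<psi>[OF that(3)]] that by (auto dest: inj_onD)
  have "adj C = C"
  proof (rule eq_matI)
    fix x y assume "x < dim_row C" "y < dim_col C"
    hence xy: "x < D" "y < D" using C by auto
    have "adj C $$ (x,y) = (\<Sum>k<D. cnj (A $$ (\<phi> y k, \<phi> x k)) * cnj (B $$ (\<psi> y k, \<psi> x k)))"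
      using C xy by (simp add: adj_index C_index)
    also have "\<dots> = C $$ (x,y)"
      unfolding C_index[OF xy] using xy
      by (intro sum.cong refl arg_cong2[of _ _ _ _ "(*)"] hermitian_cnj_index[OF A'(1,2)]
          hermitian_cnj_index[OF B'(1,2)] \<phi>D \<psi>D) auto
    finally show "adj C $$ (x,y) = C $$ (x,y)" .
  qed (use C in auto)
  obtain v where lenC: "length (eigvals C) = D"
    and v1: "\<And>i j. i < D \<Longrightarrow> j < D \<Longrightarrow> (\<Sum>x<D. cnj (v i x) * v j x) = (if i = j then 1 else 0)"
    and v2: "\<And>x y. x < D \<Longrightarrow> y < D \<Longrightarrow> (\<Sum>i<D. v i x * cnj (v i y)) = (if x = y then 1 else 0)"
    and decC: "\<And>x y. x < D \<Longrightarrow> y < D \<Longrightarrow>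
       C $$ (x,y) = (\<Sum>i<D. of_real (eigvals C ! i) * v i x * cnj (v i y))"
    by (rule hermitian_eigvals_decomposition[OF C \<open>adj C = C\<close>], rule that; simp)
  obtain w where lenB: "length (eigvals B) = D"
    and w1: "\<And>i j. i < D \<Longrightarrow> j < D \<Longrightarrow> (\<Sum>x<D. cnj (w i x) * w j x) = (if i = j then 1 else 0)"
    and w2: "\<And>x y. x < D \<Longrightarrow> y < D \<Longrightarrow> (\<Sum>i<D. w i x * cnj (w i y)) = (if x = y then 1 else 0)"
    and decB: "\<And>x y. x < D \<Longrightarrow> y < D \<Longrightarrow>
       B $$ (x,y) = (\<Sum>i<D. of_real (eigvals B ! i) * w i x * cnj (w i y))"
    by (rule hermitian_eigvals_decomposition[OF B'(1,2)], rule that; simp)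
  \<comment> \<open>\<open>T i j\<close> is the expectation in the \<open>i\<close>-th eigenvector of \<open>C\<close> of the convolution of \<open>A\<close> with the
    projection onto the \<open>j\<close>-th eigenvector of \<open>B\<close>.\<close>
  define T where "T i j = (\<Sum>k<D. \<Sum>x<D. \<Sum>y<D.
    cnj (v i x * cnj (w j (\<psi> x k))) * A $$ (\<phi> x k, \<phi> y k) * (v i y * cnj (w j (\<psi> y k))))" for i j
  define S where "S i j = Re (T i j)" for i j
  have T_real: "T i j \<in> \<real>" for i j
    unfolding T_def by (intro sum_in_Reals density_op_pullback_nonneg(1)[OF A] \<phi>D) auto
  have ST: "complex_of_real (S i j) = T i j" for i j
    using T_real unfolding S_def by simp
  have S_nonneg: "0 \<le> S i j" for i j
    unfolding S_def T_def Re_sum[of _ "{..<D}"]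
    by (intro sum_nonneg density_op_pullback_nonneg(2)[OF A, unfolded Re_sum] \<phi>D) auto
  \<comment> \<open>Row sums express unitality. Completeness of \<open>w\<close> keeps only the
    terms with \<open>\<psi> x k = \<psi> y k\<close>, which means x = y, and then the sum over
    \<open>k\<close> is the trace of \<open>A\<close>.\<close>
  have row: "(\<Sum>j<D. S i j) = 1" if i: "i < D" for i
  proof -
    have "(\<Sum>j<D. T i j) = (\<Sum>k<D. \<Sum>j<D. \<Sum>x<D. \<Sum>y<D.
        (cnj (v i x) * v i y * A $$ (\<phi> x k, \<phi> y k)) * (w j (\<psi> x k) * cnj (w j (\<psi> y k))))"
      unfolding T_def by (subst sum.swap) (intro sum.cong refl, simp add: mult_ac)
    also have "\<dots> = (\<Sum>k<D. \<Sum>x<D. \<Sum>y<D.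
        (cnj (v i x) * v i y * A $$ (\<phi> x k, \<phi> y k)) * (\<Sum>j<D. w j (\<psi> x k) * cnj (w j (\<psi> y k))))"
      unfolding sum_distrib_left by (subst sum_rotate3) (rule refl)
    also have "\<dots> = (\<Sum>k<D. \<Sum>x<D. cnj (v i x) * v i x * A $$ (\<phi> x k, \<phi> x k))"
      by (rule sum.cong[OF refl], rule sum_diagonal) (simp add: w2 \<psi>D \<psi>_inj)
    also have "\<dots> = (\<Sum>x<D. cnj (v i x) * v i x * (\<Sum>k<D. A $$ (\<phi> x k, \<phi> x k)))"
      unfolding sum_distrib_left by (rule sum.swap)
    also have "\<dots> = (\<Sum>x<D. cnj (v i x) * v i x)"
      using sum.reindex_bij_betw[OF \<phi>, of _ "\<lambda>p. A $$ (p,p)"] A'(3) by (intro sum.cong refl) simp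
    also have "\<dots> = 1" using v1 i by simp
    finally have "complex_of_real (\<Sum>j<D. S i j) = of_real 1" by (simp add: ST)
    thus ?thesis unfolding of_real_eq_iff .
  qed
  \<comment> \<open>Column sums express trace preservation. Completeness of \<open>v\<close> leaves
    x = y, and the joint bijection splits the double sum into the trace of \<open>A\<close> times
    the squared norm of an eigenvector of \<open>B\<close>.\<close>
  have col: "(\<Sum>i<D. S i j) = 1" if j: "j < D" for j
  proof -
    have "(\<Sum>i<D. T i j) = (\<Sum>k<D. \<Sum>i<D. \<Sum>x<D. \<Sum>y<D.
        (A $$ (\<phi> x k, \<phi> y k) * (w j (\<psi> x k) * cnj (w j (\<psi> y k)))) * (v i y * cnj (v i x)))"
      unfolding T_def by (subst sum.swap) (intro sum.cong refl, simp add: mult_ac)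
    also have "\<dots> = (\<Sum>k<D. \<Sum>x<D. \<Sum>y<D.
        (A $$ (\<phi> x k, \<phi> y k) * (w j (\<psi> x k) * cnj (w j (\<psi> y k)))) * (\<Sum>i<D. v i y * cnj (v i x)))"
      unfolding sum_distrib_left by (subst sum_rotate3) (rule refl)
    also have "\<dots> = (\<Sum>k<D. \<Sum>x<D. A $$ (\<phi> x k, \<phi> x k) * (w j (\<psi> x k) * cnj (w j (\<psi> x k))))"
      by (rule sum.cong[OF refl], rule sum_diagonal) (auto simp: v2)
    also have "\<dots> = (\<Sum>x<D. \<Sum>k<D. A $$ (\<phi> x k, \<phi> x k) * (w j (\<psi> x k) * cnj (w j (\<psi> x k))))"
      by (rule sum.swap)
    also have "\<dots> = (\<Sum>p<D. \<Sum>q<D. A $$ (p,p) * (w j q * cnj (w j q)))"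
      using sum.reindex_bij_betw[OF \<phi>\<psi>, of "\<lambda>(p,q). A $$ (p,p) * (w j q * cnj (w j q))"]
      by (simp add: sum.cartesian_product case_prod_unfold)
    also have "\<dots> = (\<Sum>p<D. A $$ (p,p)) * (\<Sum>q<D. cnj (w j q) * w j q)"
      by (simp add: sum_product mult_ac)
    also have "\<dots> = 1" using w1 j A'(3) by simp
    finally have "complex_of_real (\<Sum>i<D. S i j) = of_real 1" by (simp add: ST)
    thus ?thesis unfolding of_real_eq_iff .
  qed
  \<comment> \<open>Expanding \<open>B\<close> into its eigenprojections inside the quadratic form
    of \<open>C\<close> at \<open>v i\<close> yields the expectations \<open>T i j\<close>, weighted
    by the eigenvalues of \<open>B\<close>.\<close>
  have eig: "eigvals C ! i = (\<Sum>j<D. S i j * eigvals B ! j)" if i: "i < D" for i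
  proof -
    define t where "t x y k j = of_real (eigvals B ! j) * (cnj (v i x * cnj (w j (\<psi> x k))) *
      A $$ (\<phi> x k, \<phi> y k) * (v i y * cnj (w j (\<psi> y k))))" for x y k j
    have "of_real (eigvals C ! i) = (\<Sum>x<D. \<Sum>y<D. cnj (v i x) * C $$ (x,y) * v i y)"
      using eigenvalue_quadratic_form[OF v1 decC i] by simp
    also have "\<dots> = (\<Sum>x<D. \<Sum>y<D. \<Sum>k<D. \<Sum>j<D. t x y k j)"
      by (intro sum.cong refl)
        (simp add: C_index decB \<psi>D t_def sum_distrib_left sum_distrib_right mult_ac)
    also have "\<dots> = (\<Sum>k<D. \<Sum>x<D. \<Sum>y<D. \<Sum>j<D. t x y k j)" by (rule sum_rotate3)
    also have "\<dots> = (\<Sum>k<D. \<Sum>j<D. \<Sum>x<D. \<Sum>y<D. t x y k j)"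
      by (rule sum.cong[OF refl], rule sum_rotate3)
    also have "\<dots> = (\<Sum>j<D. \<Sum>k<D. \<Sum>x<D. \<Sum>y<D. t x y k j)" by (rule sum.swap)
    also have "\<dots> = (\<Sum>j<D. T i j * of_real (eigvals B ! j))"
      unfolding t_def T_def by (simp add: sum_distrib_left sum_distrib_right mult_ac)
    also have "\<dots> = of_real (\<Sum>j<D. S i j * eigvals B ! j)" by (simp add: ST)
    finally show ?thesis unfolding of_real_eq_iff .
  qed
  show "eigvals C \<prec>\<^sub>m eigvals B"
    by (rule majorized_if_doubly_stochastic[OF lenC lenB S_nonneg row col eig])
  \<comment> \<open>That \<open>C\<close> has a probability vector as spectrum follows from the
    doubly stochastic relation: nonnegative entries preserve signs, unit column sums preserve the
    total.\<close>
  have pB: "\<And>j. j < D \<Longrightarrow> 0 \<le> eigvals B ! j" "sum_list (eigvals B) = 1"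
    using prob_vec_eigvals[OF B] lenB unfolding prob_vec_def by auto
  have "0 \<le> eigvals C ! i" if "i < D" for i
    unfolding eig[OF that] by (intro sum_nonneg mult_nonneg_nonneg S_nonneg pB) auto
  moreover have "sum_list (eigvals C) = 1"
  proof -
    have "sum_list (eigvals C) = (\<Sum>i<D. \<Sum>j<D. S i j * eigvals B ! j)"
      by (simp add: sum_list_sum_nth lenC atLeast0LessThan eig)
    also have "\<dots> = (\<Sum>j<D. (\<Sum>i<D. S i j) * eigvals B ! j)"
      unfolding sum_distrib_right by (rule sum.swap)
    also have "\<dots> = sum_list (eigvals B)"
      by (simp add: col sum_list_sum_nth lenB atLeast0LessThan)
    finally show ?thesis using pB by simp
  qed
  ultimately show "prob_vec (eigvals C)"
    unfolding prob_vec_def by (auto simp: in_set_conv_nth lenC)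
qed

section \<open>Arithmetic of digit vectors\<close>

lemma sum_digits_lt:
  fixes d :: nat
  assumes "\<And>k. k < n \<Longrightarrow> f k < d"
  shows "(\<Sum>k<n. f k * d ^ k) < d ^ n"
  using assms
proof (induction n)
  case (Suc n)
  have "(\<Sum>k<Suc n. f k * d ^ k) < d ^ n + f n * d ^ n"
    using Suc by simp
  also have "\<dots> = (f n + 1) * d ^ n" by simp
  also have "\<dots> \<le> d * d ^ n" using Suc.prems[of n] by (intro mult_right_mono) auto
  finally show ?case by simp
qed simp

lemma digit_sum:
  assumes "\<And>k. k < n \<Longrightarrow> f k < d" "k < n"
  shows "digit d (\<Sum>k<n. f k * d ^ k) k = f k"
  using assms
proof (induction n)
  case (Suc n)
  have lt: "(\<Sum>k<n. f k * d ^ k) < d ^ n" using Suc.prems by (intro sum_digits_lt) auto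
  have d: "d > 0" using Suc.prems(1)[of n] by simp
  show ?case
  proof (cases "k = n")
    case True
    thus ?thesis using lt d Suc.prems(1)[of n] by (simp add: digit_def)
  next
    case False
    with Suc.prems have k: "k < n" by simp
    then obtain m where n: "n = Suc (k + m)" using less_imp_Suc_add by blast
    \<comment> \<open>For k < n the top term is a multiple of \<open>d ^ Suc k\<close> and so cannot
      affect digit \<open>k\<close>.\<close>
    have "f n * d ^ n = (f n * d ^ m * d) * d ^ k"
      unfolding n by (simp add: power_add)
    hence "(\<Sum>k<Suc n. f k * d ^ k) div d ^ k = (\<Sum>k<n. f k * d ^ k) div d ^ k + f n * d ^ m * d"
      using d by (simp only: sum.lessThan_Suc) simp
    hence "digit d (\<Sum>k<Suc n. f k * d ^ k) k = digit d (\<Sum>k<n. f k * d ^ k) k"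
      unfolding digit_def by simp
    thus ?thesis using Suc.IH Suc.prems k by simp
  qed
qed simp

text \<open>The induction strips the lowest digit by passing to \<open>i div d\<close>. With
  \<open>digit_sum\<close>, this identifies the indices below \<open>d ^ n\<close> with the vectors
  over Z_d.\<close>

lemma sum_digit:
  assumes "i < d ^ n"
  shows "(\<Sum>k<n. digit d i k * d ^ k) = i"
  using assms
proof (induction n arbitrary: i)
  case (Suc n)
  hence d: "d > 0" by (cases "d = 0") auto
  have "i div d < d ^ n" using Suc.prems d by (simp add: less_mult_imp_div_less mult.commute)
  from Suc.IH[OF this] have IH: "(\<Sum>k<n. digit d (i div d) k * d ^ k) = i div d" .
  have "digit d (i div d) k = digit d i (Suc k)" for k
    by (simp add: digit_def div_mult2_eq)
  hence "(\<Sum>k<n. digit d i (Suc k) * d ^ Suc k) = (\<Sum>k<n. digit d (i div d) k * d ^ k) * d"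
    unfolding sum_distrib_right by (intro sum.cong) (simp_all add: mult_ac)
  moreover have "(\<Sum>k<Suc n. digit d i k * d ^ k) = digit d i 0 + (\<Sum>k<n. digit d i (Suc k) * d ^ Suc k)"
    by (subst sum.lessThan_Suc_shift) simp
  ultimately show ?case unfolding IH by (simp add: digit_def)
qed simp

section \<open>Linear combinations of digit vectors\<close>

lemma digit_lin_idx:
  assumes "d > 0" "k < n"
  shows "int (digit d (lin_idx d n \<alpha> \<beta> i j) k) =
    (\<alpha> * int (digit d i k) + \<beta> * int (digit d j k)) mod int d"
proof -
  have "digit d (lin_idx d n \<alpha> \<beta> i j) k = nat ((\<alpha> * int (digit d i k) + \<beta> * int (digit d j k)) mod int d)"
    unfolding lin_idx_def using assms by (intro digit_sum) (auto simp: nat_less_iff)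
  thus ?thesis using assms by simp
qed

lemma lin_idx_lt: "d > 0 \<Longrightarrow> lin_idx d n \<alpha> \<beta> i j < d ^ n"
  unfolding lin_idx_def by (rule sum_digits_lt) (auto simp: nat_less_iff)

lemma lin_idx_cong:
  assumes "[\<alpha> = \<alpha>'] (mod int d)" "[\<beta> = \<beta>'] (mod int d)"
  shows "lin_idx d n \<alpha> \<beta> i j = lin_idx d n \<alpha>' \<beta>' i j"
proof -
  have "(\<alpha> * a + \<beta> * b) mod int d = (\<alpha>' * a + \<beta>' * b) mod int d" for a b
    using cong_add[OF cong_mult[OF assms(1) cong_refl[of a]] cong_mult[OF assms(2) cong_refl[of b]]]
    by (simp add: cong_def)
  thus ?thesis by (simp add: lin_idx_def)
qed

text \<open>Composition is a product of coefficient matrices. Together with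
  \<open>lin_idx_cong\<close>, it reduces identities between index maps to arithmetic of
  coefficients mod d.\<close>

lemma lin_idx_comp:
  assumes "d > 0"
  shows "lin_idx d n a b (lin_idx d n \<alpha> \<beta> i j) (lin_idx d n \<gamma> \<delta> i j)
    = lin_idx d n (a * \<alpha> + b * \<gamma>) (a * \<beta> + b * \<delta>) i j"
proof -
  have "(a * (x mod int d) + b * (y mod int d)) mod int d = (a * x + b * y) mod int d" for x y
    unfolding cong_def[symmetric] by (intro cong_add cong_mult cong_refl) (simp_all add: cong_def)
  moreover have "a * (\<alpha> * x + \<beta> * y) + b * (\<gamma> * x + \<delta> * y) = (a * \<alpha> + b * \<gamma>) * x + (a * \<beta> + b * \<delta>) * y"
    for x y by (simp add: algebra_simps)
  ultimately show ?thesis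
    unfolding lin_idx_def[of d n a b] lin_idx_def[of d n "a * \<alpha> + b * \<gamma>"]
    by (intro sum.cong refl) (simp only: digit_lin_idx[OF assms] lessThan_iff)
qed

lemma lin_idx_fst:
  assumes "i < d ^ n"
  shows "lin_idx d n 1 0 i j = i"
proof -
  have "nat (int (digit d i k) mod int d) = digit d i k" for k
    by (simp only: digit_def zmod_int[symmetric] nat_int mod_mod_trivial)
  thus ?thesis using sum_digit[OF assms] by (simp add: lin_idx_def)
qed

lemma lin_idx_swap: "lin_idx d n \<alpha> \<beta> i j = lin_idx d n \<beta> \<alpha> j i"
  by (simp add: lin_idx_def add.commute)

lemma lin_idx_snd: "j < d ^ n \<Longrightarrow> lin_idx d n 0 1 i j = j"
  by (simp add: lin_idx_swap[of d n 0 1] lin_idx_fst)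

section \<open>Invertible linear maps modulo a prime\<close>

lemma cong_inverse_prime:
  assumes "prime d" "\<not> [\<alpha> = 0] (mod int d)"
  obtains a where "[a * \<alpha> = 1] (mod int d)"
proof -
  have "coprime (int d) \<alpha>"
    using assms by (intro prime_imp_coprime) (auto simp: cong_0_iff)
  thus thesis
    using that cong_solve_coprime_int[of \<alpha> "int d"] by (auto simp: coprime_commute mult.commute)
qed

text \<open>With \<open>j\<close> fixed this is an affine map whose left inverse uses an inverse
  \<open>a\<close> of the leading coefficient mod d. An injective self-map of a finite set is
  onto.\<close>

lemma bij_betw_lin_idx_fst:
  assumes d: "prime d" and \<alpha>: "\<not> [\<alpha> = 0] (mod int d)" and j: "j < d ^ n"
  shows "bij_betw (\<lambda>i. lin_idx d n \<alpha> \<beta> i j) {..<d ^ n} {..<d ^ n}"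
proof -
  have d0: "d > 0" using d by (simp add: prime_gt_0_nat)
  obtain a where a: "[a * \<alpha> = 1] (mod int d)"
    using cong_inverse_prime[OF d \<alpha>] .
  have "lin_idx d n a (- a * \<beta>) (lin_idx d n \<alpha> \<beta> i j) j = i" if "i < d ^ n" for i
  proof -
    \<comment> \<open>The fixed vector \<open>j\<close> is written as the combination with
      coefficients 0 and 1, so that \<open>lin_idx_comp\<close> applies.\<close>
    have "lin_idx d n a (- a * \<beta>) (lin_idx d n \<alpha> \<beta> i j) (lin_idx d n 0 1 i j)
        = lin_idx d n (a * \<alpha>) 0 i j" using d0 by (simp add: lin_idx_comp)
    also have "\<dots> = lin_idx d n 1 0 i j"
      using a by (intro lin_idx_cong) auto
    finally show ?thesis using that j by (simp add: lin_idx_fst lin_idx_snd)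
  qed
  hence "inj_on (\<lambda>i. lin_idx d n \<alpha> \<beta> i j) {..<d ^ n}"
    by (intro inj_on_inverseI[where g = "\<lambda>i. lin_idx d n a (- a * \<beta>) i j"]) simp
  moreover have "(\<lambda>i. lin_idx d n \<alpha> \<beta> i j) ` {..<d ^ n} \<subseteq> {..<d ^ n}"
    using lin_idx_lt[OF d0] by auto
  ultimately show ?thesis
    by (simp add: bij_betw_def endo_inj_surj)
qed

lemma bij_betw_lin_idx_snd:
  assumes "prime d" "\<not> [\<beta> = 0] (mod int d)" "i < d ^ n"
  shows "bij_betw (\<lambda>j. lin_idx d n \<alpha> \<beta> i j) {..<d ^ n} {..<d ^ n}"
  unfolding lin_idx_swap[of d n \<alpha> \<beta> i] by (rule bij_betw_lin_idx_fst[OF assms])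

lemma inv_det_cong:
  assumes "prime d" "\<not> [g00 * g11 - g01 * g10 = 0] (mod int d)"
  shows "[inv_det d g00 g01 g10 g11 * (g00 * g11 - g01 * g10) = 1] (mod int d)"
  unfolding inv_det_def by (rule someI_ex) (use cong_inverse_prime[OF assms] in blast)

text \<open>The key unitary acts on pairs of vectors by the inverse of the transpose of G, written
  through the adjugate; the inverse action is the transpose of G itself.\<close>

lemma key_map_inverse:
  fixes g00 g01 g10 g11 N :: int
  assumes d: "d > 0" and N: "[N * (g00 * g11 - g01 * g10) = 1] (mod int d)"
    and "x < d ^ n" "y < d ^ n"
  shows "lin_idx d n (N * g11) (- N * g10) (lin_idx d n g00 g10 x y) (lin_idx d n g01 g11 x y) = x"
    and "lin_idx d n (- N * g01) (N * g00) (lin_idx d n g00 g10 x y) (lin_idx d n g01 g11 x y) = y"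
    and "lin_idx d n g00 g10 (lin_idx d n (N * g11) (- N * g10) x y) (lin_idx d n (- N * g01) (N * g00) x y) = x"
    and "lin_idx d n g01 g11 (lin_idx d n (N * g11) (- N * g10) x y) (lin_idx d n (- N * g01) (N * g00) x y) = y"
proof -
  \<comment> \<open>As an integer, every composed coefficient is either 0 or \<open>N\<close> times
    the determinant. With \<open>z\<close> and \<open>o\<close>, the four claims become polynomial
    identities.\<close>
  have z: "z = 0 \<Longrightarrow> [z = 0] (mod int d)" for z :: int by simp
  have o: "z = N * (g00 * g11 - g01 * g10) \<Longrightarrow> [z = 1] (mod int d)" for z using N by simp
  have "lin_idx d n a b x y = x" if "[a = 1] (mod int d)" "[b = 0] (mod int d)" for a b
    using lin_idx_cong[OF that] lin_idx_fst assms by simp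
  note 1 = this[OF o z]
  have "lin_idx d n a b x y = y" if "[a = 0] (mod int d)" "[b = 1] (mod int d)" for a b
    using lin_idx_cong[OF that] lin_idx_snd assms by simp
  note 2 = this[OF z o]
  show "lin_idx d n (N * g11) (- N * g10) (lin_idx d n g00 g10 x y) (lin_idx d n g01 g11 x y) = x"
    unfolding lin_idx_comp[OF d] by (rule 1) (auto simp: algebra_simps)
  show "lin_idx d n (- N * g01) (N * g00) (lin_idx d n g00 g10 x y) (lin_idx d n g01 g11 x y) = y"
    unfolding lin_idx_comp[OF d] by (rule 2) (auto simp: algebra_simps)
  show "lin_idx d n g00 g10 (lin_idx d n (N * g11) (- N * g10) x y) (lin_idx d n (- N * g01) (N * g00) x y) = x"
    unfolding lin_idx_comp[OF d] by (rule 1) (auto simp: algebra_simps)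
  show "lin_idx d n g01 g11 (lin_idx d n (N * g11) (- N * g10) x y) (lin_idx d n (- N * g01) (N * g00) x y) = y"
    unfolding lin_idx_comp[OF d] by (rule 2) (auto simp: algebra_simps)
qed

section \<open>The quantum convolution\<close>

text \<open>Row \<open>r\<close> of \<open>U\<close> has its only 1 in column \<open>V r\<close>, so
  both matrix products collapse and conjugation merely relabels entries.\<close>

lemma permutation_conj_index:
  fixes M :: "complex mat"
  assumes M: "M \<in> carrier_mat m m" and V: "\<And>r. r < m \<Longrightarrow> V r < m"
    and rs: "r < m" "s < m"
  defines "U \<equiv> mat m m (\<lambda>(r,c). if c = V r then 1 else 0)"
  shows "(U * M * adj U) $$ (r,s) = M $$ (V r, V s)"
proof -
  have U: "U \<in> carrier_mat m m" unfolding U_def by simp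
  have UM: "(U * M) $$ (r,c) = M $$ (V r, c)" if "c < m" for c
  proof -
    have "(U * M) $$ (r,c) = (\<Sum>x<m. U $$ (r,x) * M $$ (x,c))"
      using U M rs that by (simp add: scalar_prod_def lessThan_atLeast0)
    also have "\<dots> = (\<Sum>x<m. if x = V r then M $$ (x,c) else 0)"
      using rs by (intro sum.cong refl) (auto simp: U_def)
    finally show ?thesis using V rs by simp
  qed
  have "(U * M * adj U) $$ (r,s) = (\<Sum>c<m. (U * M) $$ (r,c) * adj U $$ (c,s))"
    using U M rs by (subst index_mult_mat(1)) (auto simp: scalar_prod_def lessThan_atLeast0)
  also have "\<dots> = (\<Sum>c<m. if c = V s then M $$ (V r, c) else 0)"
    using rs U by (intro sum.cong refl) (auto simp: UM adj_index simp del: index_mult_mat(1), auto simp: U_def)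
  finally show ?thesis using V rs by simp
qed

lemma pair_index_lt: "a < D \<Longrightarrow> b < D \<Longrightarrow> a * D + b < D * (D :: nat)"
proof -
  assume "a < D" "b < D"
  hence "a * D + b < (a + 1) * D" by simp
  also have "\<dots> \<le> D * D" using \<open>a < D\<close> by (intro mult_right_mono) auto
  finally show ?thesis .
qed

lemma kron_index:
  assumes "A \<in> carrier_mat D D" "B \<in> carrier_mat D D" "a < D" "b < D" "a' < D" "b' < D"
  shows "kron A B $$ (a * D + b, a' * D + b') = A $$ (a,a') * B $$ (b,b')"
  using assms by (simp add: kron_def pair_index_lt)

text \<open>Conjugation relabels the entries of the tensor product by the transpose of G, and the
  partial trace sums over a second index \<open>k\<close> common to row and column.\<close>

lemma conv_index:
  assumes d: "prime d" and det: "\<not> [g00 * g11 - g01 * g10 = 0] (mod int d)"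
    and R: "\<rho> \<in> carrier_mat (d ^ n) (d ^ n)" and S: "\<sigma> \<in> carrier_mat (d ^ n) (d ^ n)"
    and x: "x < d ^ n" and y: "y < d ^ n"
  shows "conv d n g00 g01 g10 g11 \<rho> \<sigma> $$ (x,y) =
    (\<Sum>k<d ^ n. \<rho> $$ (lin_idx d n g00 g10 x k, lin_idx d n g00 g10 y k)
              * \<sigma> $$ (lin_idx d n g01 g11 x k, lin_idx d n g01 g11 y k))"
proof -
  define D where "D = d ^ n"
  define N where "N = inv_det d g00 g01 g10 g11"
  have d0: "d > 0" using d by (simp add: prime_gt_0_nat)
  hence D0: "D > 0" unfolding D_def by simp
  note inv = key_map_inverse[OF d0 inv_det_cong[OF d det], folded N_def, of _ n, folded D_def]
  have lt: "lin_idx d n \<alpha> \<beta> i j < D" for \<alpha> \<beta> i j unfolding D_def using lin_idx_lt[OF d0] .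
  define Umap where "Umap c = lin_idx d n (N * g11) (- N * g10) (c div D) (c mod D) * D
                     + lin_idx d n (- N * g01) (N * g00) (c div D) (c mod D)" for c
  define V where "V r = lin_idx d n g00 g10 (r div D) (r mod D) * D
                     + lin_idx d n g01 g11 (r div D) (r mod D)" for r
  have dm: "c div D < D" "c mod D < D" if "c < D * D" for c
    using that D0 by (auto simp: less_mult_imp_div_less)
  have V_lt: "V r < D * D" for r unfolding V_def by (intro pair_index_lt lt)
  have UV: "Umap (V r) = r" if "r < D * D" for r
    unfolding Umap_def V_def using lt dm[OF that] D0 by (simp add: inv[simplified])
  have VU: "V (Umap c) = c" if "c < D * D" for c
    unfolding Umap_def V_def using lt dm[OF that] D0 by (simp add: inv[simplified])
  \<comment> \<open>\<open>key_U\<close> describes the permutation by columns, as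
    \<open>r = Umap c\<close>. Because \<open>V\<close> inverts \<open>Umap\<close>, it can be read
    by rows, as \<open>permutation_conj_index\<close> expects.\<close>
  have U: "key_U d n g00 g01 g10 g11 = mat (D * D) (D * D) (\<lambda>(r,c). if c = V r then 1 else 0)"
    unfolding key_U_def Let_def D_def[symmetric] N_def[symmetric] Umap_def[symmetric]
    by (intro eq_matI) (auto simp: UV VU)
  have K: "kron \<rho> \<sigma> \<in> carrier_mat (D * D) (D * D)"
    using R S unfolding kron_def D_def by auto
  have "conv d n g00 g01 g10 g11 \<rho> \<sigma> $$ (x,y) = (\<Sum>k<D. kron \<rho> \<sigma> $$ (V (x * D + k), V (y * D + k)))"
    unfolding conv_def Let_def ptrace_B_def U D_def[symmetric]
    using x y by (simp add: permutation_conj_index[OF K V_lt] pair_index_lt del: index_mult_mat flip: D_def)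
  also have "\<dots> = (\<Sum>k<D. \<rho> $$ (lin_idx d n g00 g10 x k, lin_idx d n g00 g10 y k)
              * \<sigma> $$ (lin_idx d n g01 g11 x k, lin_idx d n g01 g11 y k))"
    unfolding V_def by (intro sum.cong refl) (simp add: kron_index[OF R S, folded D_def] lt)
  finally show ?thesis unfolding D_def .
qed

lemma conv_carrier: "conv d n g00 g01 g10 g11 \<rho> \<sigma> \<in> carrier_mat (d ^ n) (d ^ n)"
  by (simp add: conv_def ptrace_B_def Let_def)

lemma bij_betw_key_map:
  assumes d: "prime d" and det: "\<not> [g00 * g11 - g01 * g10 = 0] (mod int d)"
  shows "bij_betw (\<lambda>(x,k). (lin_idx d n g00 g10 x k, lin_idx d n g01 g11 x k))
    ({..<d ^ n} \<times> {..<d ^ n}) ({..<d ^ n} \<times> {..<d ^ n})"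
proof -
  have d0: "d > 0" using d by (simp add: prime_gt_0_nat)
  define N where "N = inv_det d g00 g01 g10 g11"
  note inv = key_map_inverse[OF d0 inv_det_cong[OF d det], folded N_def, of _ n]
  show ?thesis
    by (rule bij_betw_byWitness[where f' = "\<lambda>(i,j). (lin_idx d n (N * g11) (- N * g10) i j,
          lin_idx d n (- N * g01) (N * g00) i j)"])
      (use inv lin_idx_lt[OF d0] in auto)
qed

text \<open>Invertibility of g10 makes g00 x + g10 k bijective in \<open>k\<close>, and
  invertibility of g01 makes g01 x + g11 k bijective in \<open>x\<close>.\<close>

lemma conv_majorized_right:
  assumes "prime d" "\<not> [g00 * g11 - g01 * g10 = 0] (mod int d)"
    and "density_op (d ^ n) \<rho>" "density_op (d ^ n) \<sigma>"
    and "\<not> [g01 = 0] (mod int d)" "\<not> [g10 = 0] (mod int d)"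
  shows "eigvals (conv d n g00 g01 g10 g11 \<rho> \<sigma>) \<prec>\<^sub>m eigvals \<sigma>"
    and "prob_vec (eigvals (conv d n g00 g01 g10 g11 \<rho> \<sigma>))"
proof -
  note * = eigvals_convolution_majorized[OF assms(3,4) conv_carrier
      conv_index[OF assms(1,2) density_opD(1)[OF assms(3)] density_opD(1)[OF assms(4)]]
      bij_betw_lin_idx_snd[OF assms(1,6)] bij_betw_lin_idx_fst[OF assms(1,5)]
      bij_betw_key_map[OF assms(1,2)]]
  show "eigvals (conv d n g00 g01 g10 g11 \<rho> \<sigma>) \<prec>\<^sub>m eigvals \<sigma>" by (rule *(1))
  show "prob_vec (eigvals (conv d n g00 g01 g10 g11 \<rho> \<sigma>))" by (rule *(2))
qed

text \<open>The general theorem with the two states exchanged: g11 now provides bijectivity in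
  \<open>k\<close> and g00 in \<open>x\<close>. The joint map is composed with the swap of
  components, and the factors in the entry formula are commuted.\<close>

lemma conv_majorized_left:
  assumes "prime d" "\<not> [g00 * g11 - g01 * g10 = 0] (mod int d)"
    and "density_op (d ^ n) \<rho>" "density_op (d ^ n) \<sigma>"
    and "\<not> [g00 = 0] (mod int d)" "\<not> [g11 = 0] (mod int d)"
  shows "eigvals (conv d n g00 g01 g10 g11 \<rho> \<sigma>) \<prec>\<^sub>m eigvals \<rho>"
    and "prob_vec (eigvals (conv d n g00 g01 g10 g11 \<rho> \<sigma>))"
proof -
  have swap: "bij_betw prod.swap ({..<d ^ n} \<times> {..<d ^ n}) ({..<d ^ n} \<times> {..<d ^ n})"
    by (rule bij_betw_byWitness[where f' = prod.swap]) auto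
  have key: "bij_betw (\<lambda>(x,k). (lin_idx d n g01 g11 x k, lin_idx d n g00 g10 x k))
      ({..<d ^ n} \<times> {..<d ^ n}) ({..<d ^ n} \<times> {..<d ^ n})"
    using bij_betw_trans[OF bij_betw_key_map[OF assms(1,2)] swap]
    by (simp add: o_def case_prod_unfold)
  note index = conv_index[OF assms(1,2) density_opD(1)[OF assms(3)] density_opD(1)[OF assms(4)],
      unfolded mult.commute[of "\<rho> $$ _"]]
  note * = eigvals_convolution_majorized[OF assms(4,3) conv_carrier index
      bij_betw_lin_idx_snd[OF assms(1,6)] bij_betw_lin_idx_fst[OF assms(1,5)] key]
  show "eigvals (conv d n g00 g01 g10 g11 \<rho> \<sigma>) \<prec>\<^sub>m eigvals \<rho>" by (rule *(1))
  show "prob_vec (eigvals (conv d n g00 g01 g10 g11 \<rho> \<sigma>))" by (rule *(2))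
qed

theorem mainTheorem10:
  fixes d n :: nat and g00 g01 g10 g11 :: int and \<rho> \<sigma> :: "complex mat"
  assumes "prime d" and "n \<ge> 1"
    and "\<not> [g00 * g11 - g01 * g10 = 0] (mod int d)"
    and "density_op (d ^ n) \<rho>" and "density_op (d ^ n) \<sigma>"
  shows "(odd_parity_positive d g00 g01 g10 g11 \<longrightarrow>
            eigvals (conv d n g00 g01 g10 g11 \<rho> \<sigma>) \<prec>\<^sub>m eigvals \<sigma> \<and>
            (\<forall>f. schur_concave f \<longrightarrow> f (eigvals (conv d n g00 g01 g10 g11 \<rho> \<sigma>)) \<ge> f (eigvals \<sigma>)))
       \<and> (even_parity_positive d g00 g01 g10 g11 \<longrightarrow>
            eigvals (conv d n g00 g01 g10 g11 \<rho> \<sigma>) \<prec>\<^sub>m eigvals \<rho> \<and>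
            (\<forall>f. schur_concave f \<longrightarrow> f (eigvals (conv d n g00 g01 g10 g11 \<rho> \<sigma>)) \<ge> f (eigvals \<rho>)))
       \<and> (positive_G d g00 g01 g10 g11 \<longrightarrow>
            eigvals (conv d n g00 g01 g10 g11 \<rho> \<sigma>) \<prec>\<^sub>m eigvals \<sigma> \<and>
            eigvals (conv d n g00 g01 g10 g11 \<rho> \<sigma>) \<prec>\<^sub>m eigvals \<rho> \<and>
            (\<forall>f. schur_concave f \<longrightarrow>
               f (eigvals (conv d n g00 g01 g10 g11 \<rho> \<sigma>)) \<ge> max (f (eigvals \<rho>)) (f (eigvals \<sigma>))))"
proof -
  let ?p = "eigvals (conv d n g00 g01 g10 g11 \<rho> \<sigma>)"
  have odd: "?p \<prec>\<^sub>m eigvals \<sigma> \<and> (\<forall>f. schur_concave f \<longrightarrow> f ?p \<ge> f (eigvals \<sigma>))"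
    if "odd_parity_positive d g00 g01 g10 g11"
    using conv_majorized_right[OF assms(1,3-5)] prob_vec_eigvals[OF assms(5)] that
    unfolding odd_parity_positive_def schur_concave_def by blast
  have even: "?p \<prec>\<^sub>m eigvals \<rho> \<and> (\<forall>f. schur_concave f \<longrightarrow> f ?p \<ge> f (eigvals \<rho>))"
    if "even_parity_positive d g00 g01 g10 g11"
    using conv_majorized_left[OF assms(1,3-5)] prob_vec_eigvals[OF assms(4)] that
    unfolding even_parity_positive_def schur_concave_def by blast
  show ?thesis
    using odd even unfolding positive_G_def by simp
qed

end
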